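(* Let $G$ be a finite group with $Z(G)=1$, let $\Gamma$ be the commuting graph of $G$ and let $\pi$ be the prime graph of $G$. Let $\Gamma/G$ be a set of representatives of the $G$-classes of connected components of $\Gamma$ (where $G$ acts by conjugation). Then the map $\Psi \mapsto \pi(\Psi)$ is a bijection between $\Gamma/G$ and the set of connected components of $\pi$. Furthermore, $\Gamma$ is connected if and only if $\pi$ is connected.
   Context: The commuting graph of a group $G$ is the graph whose vertices are the non-central elements of $G$, with two distinct vertices adjacent if and only if they commute. The prime graph $\pi$ of a finite group $G$ has as vertices the primes dividing $|G|$, with two distinct primes $r$ and $s$ adjacent if and only if $G$ has an element of order $rs$. $G$ acts on its commuting graph by conjugation, hence permutes the connected components. For a connected component $\Psi$ of the commuting graph, $\pi(\Psi)$ denotes the set of primes which divide the order of some element of $\Psi$; connected components of the prime graph are identified with their vertex sets. *)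

theory Defs
  imports
    "HOL-Algebra.Algebra"
    "HOL-Computational_Algebra.Primes"
    "Graph_Theory.Digraph_Component"
begin

text \<open>
  An undirected simple graph is modelled, as usual in the theory of digraphs imported here, by a
  symmetric loop-free digraph. For such a digraph the strongly connected components are the connected
  components of the graph; \<open>sccs_verts\<close> gives their vertex sets. \<open>Digraph_Component.connected\<close> is
  false for the null graph.
\<close>

definition group_center :: "('a, 'b) monoid_scheme \<Rightarrow> 'a set" where
  "group_center G = {z \<in> carrier G. \<forall>g \<in> carrier G. z \<otimes>\<^bsub>G\<^esub> g = g \<otimes>\<^bsub>G\<^esub> z}"

definition commuting_graph :: "('a, 'b) monoid_scheme \<Rightarrow> 'a pair_pre_digraph" where
  "commuting_graph G =
     \<lparr> pverts = carrier G - group_center G,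
       parcs = {(x, y). x \<in> carrier G - group_center G \<and> y \<in> carrier G - group_center G \<and>
                        x \<noteq> y \<and> x \<otimes>\<^bsub>G\<^esub> y = y \<otimes>\<^bsub>G\<^esub> x} \<rparr>"

definition prime_graph :: "('a, 'b) monoid_scheme \<Rightarrow> nat pair_pre_digraph" where
  "prime_graph G =
     \<lparr> pverts = {p. normalization_semidom_class.prime p \<and> p dvd order G},
       parcs = {(r, s). normalization_semidom_class.prime r \<and> r dvd order G \<and>
                        normalization_semidom_class.prime s \<and> s dvd order G \<and>
                        r \<noteq> s \<and> (\<exists>g \<in> carrier G. group.ord G g = r * s)} \<rparr>"

lemma pair_sym_digraph_commuting_graph: "pair_sym_digraph (commuting_graph G)"
  by unfold_locales
     (auto simp: commuting_graph_def symmetric_def arcs_ends_conv with_proj_def sym_def)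

lemma pair_loopfree_digraph_commuting_graph: "pair_loopfree_digraph (commuting_graph G)"
  by unfold_locales (auto simp: commuting_graph_def)

lemma pair_sym_digraph_prime_graph: "pair_sym_digraph (prime_graph G)"
  by unfold_locales
     (auto simp: prime_graph_def symmetric_def arcs_ends_conv with_proj_def sym_def mult.commute)

lemma pair_loopfree_digraph_prime_graph: "pair_loopfree_digraph (prime_graph G)"
  by unfold_locales (auto simp: prime_graph_def)

definition graph_components :: "'a pair_pre_digraph \<Rightarrow> 'a set set" where
  "graph_components \<Gamma> = pre_digraph.sccs_verts (with_proj \<Gamma>)"

text \<open>
  The map is restricted to the components, since actions in \<open>Group_Action\<close> are by extensional maps.
\<close>

definition component_conjugation :: "('a, 'b) monoid_scheme \<Rightarrow> 'a \<Rightarrow> 'a set \<Rightarrow> 'a set" where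
  "component_conjugation G g =
     (\<lambda>\<Psi> \<in> graph_components (commuting_graph G). (\<lambda>x. g \<otimes>\<^bsub>G\<^esub> x \<otimes>\<^bsub>G\<^esub> inv\<^bsub>G\<^esub> g) ` \<Psi>)"

definition component_class_representatives :: "('a, 'b) monoid_scheme \<Rightarrow> 'a set set \<Rightarrow> bool" where
  "component_class_representatives G R \<longleftrightarrow>
     R \<subseteq> graph_components (commuting_graph G) \<and>
     (\<forall>C \<in> orbits G (graph_components (commuting_graph G)) (component_conjugation G).
        \<exists>!\<Psi>. \<Psi> \<in> R \<and> \<Psi> \<in> C)"

definition component_primes :: "('a, 'b) monoid_scheme \<Rightarrow> 'a set \<Rightarrow> nat set" where
  "component_primes G \<Psi> = {p. normalization_semidom_class.prime p \<and> (\<exists>x \<in> \<Psi>. p dvd group.ord G x)}"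

end

theory Submission
  imports Defs
begin

text \<open>
  Let \<open>P\<close> be a Sylow \<open>p\<close>-subgroup and \<open>z \<noteq> 1\<close> in its centre. The conjugacy class of \<open>z\<close> has size prime
  to \<open>p\<close>, so every element of order \<open>p\<close> fixes, that is commutes with, some conjugate of \<open>z\<close>. Hence all
  components of the commuting graph that contain an element of order \<open>p\<close> are conjugate. Commuting
  elements of distinct prime orders \<open>p\<close>, \<open>q\<close> have a product of order \<open>p q\<close>, so the primes of a component
  lie in one component of the prime graph; conversely an element of order \<open>p q\<close> lies in a component
  containing elements of both orders, so these primes fill that component.

  If the prime graph is connected, the components of the commuting graph form a single orbit, of
  size \<open>k\<close> say. With \<open>H\<close> the stabilizer of a component \<open>\<Psi>\<close>, this gives \<open>|G| = k |H|\<close> and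
  \<open>|G| - 1 = k |\<Psi>|\<close>. Since \<open>\<Psi> \<union> {1} \<subseteq> H\<close>, it follows that \<open>k \<le> 1\<close>.
\<close>

section \<open>Components of symmetric digraphs\<close>

context pair_sym_digraph
begin

lemma graph_components_nonempty: "S \<in> graph_components G \<Longrightarrow> S \<noteq> {}"
  by (auto simp: graph_components_def in_sccs_verts_conv_reachable)

lemma graph_components_subset: "S \<in> graph_components G \<Longrightarrow> S \<subseteq> pverts G"
  using sccs_verts_subsets by (auto simp: graph_components_def)

lemma graph_components_eqI:
  assumes "S \<in> graph_components G" "T \<in> graph_components G" "x \<in> S" "x \<in> T"
  shows "S = T"
  using assms sccs_verts_disjoint unfolding graph_components_def by blast

lemma graph_components_cover:
  assumes "x \<in> pverts G"
  obtains S where "S \<in> graph_components G" "x \<in> S"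
proof
  show "scc_of x \<in> graph_components G"
    using scc_of_in_sccs_verts assms by (simp add: graph_components_def)
  show "x \<in> scc_of x"
    using in_scc_of_self assms by simp
qed

lemma graph_components_closed:
  assumes S: "S \<in> graph_components G" and x: "x \<in> S" and xy: "(x, y) \<in> parcs G"
  shows "y \<in> S"
proof (rule ccontr)
  assume "y \<notin> S"
  moreover have "x \<rightarrow>\<^sup>*\<^bsub>G\<^esub> y"
    using xy reachable_adjI by auto
  moreover from this have "y \<rightarrow>\<^sup>*\<^bsub>G\<^esub> x"
    by (rule symmetric_reachable[OF sym_arcs])
  ultimately show False
    using S x unfolding graph_components_def in_sccs_verts_conv_reachable by blast
qed

text \<open>Induction along paths inside a component. Every later proof that a property spreads over
  a component, in either graph, takes for \<open>A\<close> the set of vertices having that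
  property.\<close>

lemma graph_component_subset_closed:
  assumes S: "S \<in> graph_components G" and u: "u \<in> S" "u \<in> A"
    and closed: "\<And>x y. x \<in> A \<Longrightarrow> (x, y) \<in> parcs G \<Longrightarrow> y \<in> A"
  shows "S \<subseteq> A"
proof
  fix v assume "v \<in> S"
  with S u have "u \<rightarrow>\<^sup>*\<^bsub>G\<^esub> v"
    unfolding graph_components_def in_sccs_verts_conv_reachable by blast
  then show "v \<in> A"
    by (induction rule: reachable_induct) (use u closed in auto)
qed

text \<open>For symmetric digraphs connectedness and strong connectedness coincide. Exactly one
  component is demanded, not at most one, because the null graph counts as not connected.\<close>

lemma connected_iff_graph_components:
  "Digraph_Component.connected (with_proj G) \<longleftrightarrow> (\<exists>S. graph_components G = {S})"
proof
  assume "Digraph_Component.connected (with_proj G)"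
  then have sc: "strongly_connected (with_proj G)"
    by (rule symmetric_connected_imp_strongly_connected[OF pair_sym_arcs])
  then obtain x where x: "x \<in> pverts G"
    by (auto simp: strongly_connected_def)
  then obtain S where S: "S \<in> graph_components G" "x \<in> S"
    by (rule graph_components_cover)
  have "T = S" if T: "T \<in> graph_components G" for T
  proof -
    obtain y where y: "y \<in> T"
      using graph_components_nonempty[OF T] by blast
    then have "y \<in> pverts G"
      using graph_components_subset[OF T] by blast
    with sc x have "x \<rightarrow>\<^sup>*\<^bsub>G\<^esub> y" "y \<rightarrow>\<^sup>*\<^bsub>G\<^esub> x"
      by (auto simp: strongly_connected_def)
    then have "y \<in> S"
      using S unfolding graph_components_def in_sccs_verts_conv_reachable by blast
    then show ?thesis
      using graph_components_eqI T S(1) y by blast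
  qed
  then show "\<exists>S. graph_components G = {S}"
    using S(1) by blast
next
  assume "\<exists>S. graph_components G = {S}"
  then obtain S where S: "graph_components G = {S}" by blast
  have "strongly_connected (with_proj G)"
    unfolding strongly_connected_def
  proof (intro conjI ballI)
    show "verts (with_proj G) \<noteq> {}"
      using graph_components_nonempty graph_components_subset S by auto
    fix u v assume "u \<in> verts (with_proj G)" "v \<in> verts (with_proj G)"
    then have "u \<in> S" "v \<in> S"
      using graph_components_cover S by (metis singletonD with_proj_simps(1))+
    then show "u \<rightarrow>\<^sup>*\<^bsub>G\<^esub> v"
      using S unfolding graph_components_def in_sccs_verts_conv_reachable
      by (metis in_sccs_verts_conv_reachable singletonI)
  qed
  then show "Digraph_Component.connected (with_proj G)"
    unfolding connected_def by (simp add: strongly_connected_def reachable_mk_symmetric_eq[OF pair_sym_arcs])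
qed

end


section \<open>Fixed points of \<open>p\<close>-groups\<close>

text \<open>The points that are not fixed split into orbits whose sizes are powers of
  \<open>p\<close> greater than 1. An invariant subset \<open>F\<close> is allowed in place of
  \<open>E\<close>, so that the conjugation action on the whole group serves both for a Sylow
  subgroup and for a conjugacy class.\<close>

lemma (in group_action) p_group_fixed_points:
  assumes p: "normalization_semidom_class.prime (p::nat)"
    and order: "order G = p ^ n"
    and F: "F \<subseteq> E" "finite F" "\<And>g x. g \<in> carrier G \<Longrightarrow> x \<in> F \<Longrightarrow> \<phi> g x \<in> F"
  shows "p dvd card (F - {x. \<forall>g \<in> carrier G. \<phi> g x = x})"
proof -
  define Y where "Y = F - {x. \<forall>g \<in> carrier G. \<phi> g x = x}"
  interpret group G
    using group_hom group_hom.axioms(1) by blast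
  have orbF: "orbit G \<phi> x \<subseteq> F" if "x \<in> F" for x
    using F(3) that by (auto simp: orbit_def)
  have eq: "orbit G \<phi> y = orbit G \<phi> x" if "x \<in> F" "y \<in> orbit G \<phi> x" for x y
  proof -
    have yE: "x \<in> E" "y \<in> E" "y \<in> F" using that orbF F(1) by blast+
    have "x \<in> orbit G \<phi> y" using orbit_sym yE that by blast
    moreover have "orbit G \<phi> y \<subseteq> E" "orbit G \<phi> x \<subseteq> E"
      using orbF[OF yE(3)] orbF[OF that(1)] F(1) by blast+
    ultimately show ?thesis
      using orbit_trans[of x y] orbit_trans[of y x] that yE by blast
  qed
  have orbY: "orbit G \<phi> x \<subseteq> Y" if "x \<in> Y" for x
  proof
    fix y assume y: "y \<in> orbit G \<phi> x"
    have xX: "x \<in> F" "x \<in> E" using that F(1) by (auto simp: Y_def)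
    have "y \<in> F" using y orbF xX by blast
    \<comment> \<open>A fixed point forms an orbit by itself, so it cannot lie in the orbit of the
      moved point \<open>x\<close>.\<close>
    moreover have "\<not> (\<forall>g \<in> carrier G. \<phi> g y = y)"
    proof
      assume "\<forall>g \<in> carrier G. \<phi> g y = y"
      then have "orbit G \<phi> y \<subseteq> {y}" by (auto simp: orbit_def)
      with eq[OF xX(1) y] orbit_refl[OF xX(2)] have "orbit G \<phi> x \<subseteq> {x}" by auto
      then have "\<forall>g \<in> carrier G. \<phi> g x = x" by (auto simp: orbit_def)
      with that show False by (simp add: Y_def)
    qed
    ultimately show "y \<in> Y" by (simp add: Y_def)
  qed
  have UnY: "\<Union> (orbit G \<phi> ` Y) = Y"
  proof
    show "\<Union> (orbit G \<phi> ` Y) \<subseteq> Y"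
      by (rule UN_least) (rule orbY)
    show "Y \<subseteq> \<Union> (orbit G \<phi> ` Y)"
    proof
      fix x assume "x \<in> Y"
      moreover from this have "x \<in> E" using F(1) by (auto simp: Y_def)
      ultimately show "x \<in> \<Union> (orbit G \<phi> ` Y)" using orbit_refl by blast
    qed
  qed
  have "p dvd card (\<Union> (orbit G \<phi> ` Y))"
  proof (rule dvd_partition)
    show "finite (\<Union> (orbit G \<phi> ` Y))"
      unfolding UnY using F(2) by (simp add: Y_def)
    show "\<forall>c \<in> orbit G \<phi> ` Y. p dvd card c"
    proof safe
      fix x assume x: "x \<in> Y"
      then have xE: "x \<in> E" "x \<in> F" using F(1) by (auto simp: Y_def)
      have "card (orbit G \<phi> x) dvd p ^ n"
        using orbit_stabilizer_theorem[OF xE(1)] order by (metis dvd_triv_left)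
      then obtain k where k: "card (orbit G \<phi> x) = p ^ k"
        using p divides_primepow_nat by blast
      \<comment> \<open>An orbit of size \<open>p ^ 0\<close> would be a fixed point, and these were
        removed from \<open>Y\<close>.\<close>
      have "k \<noteq> 0"
      proof
        assume "k = 0"
        then have "card (orbit G \<phi> x) = 1" using k by simp
        then have "orbit G \<phi> x = {x}"
          using orbit_refl[OF xE(1)] by (metis card_1_singletonE singletonD)
        then have "\<forall>g \<in> carrier G. \<phi> g x = x" by (auto simp: orbit_def)
        with x show False by (simp add: Y_def)
      qed
      then show "p dvd card (orbit G \<phi> x)" using k by simp
    qed
    show "\<forall>c1 \<in> orbit G \<phi> ` Y. \<forall>c2 \<in> orbit G \<phi> ` Y. c1 \<noteq> c2 \<longrightarrow> c1 \<inter> c2 = {}"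
      using eq unfolding Y_def by blast
  qed
  then show ?thesis by (simp add: UnY) (simp add: Y_def)
qed


section \<open>Conjugation and orders of elements\<close>

context group
begin

text \<open>Conjugation without restriction to the carrier, for rewriting; the extensional maps
  required of group actions are reduced to it.\<close>

definition conjugate :: "'a \<Rightarrow> 'a \<Rightarrow> 'a" where
  "conjugate g x = g \<otimes> x \<otimes> inv g"

lemma conjugate_closed [simp]: "g \<in> carrier G \<Longrightarrow> x \<in> carrier G \<Longrightarrow> conjugate g x \<in> carrier G"
  by (simp add: conjugate_def)

lemma conjugate_one [simp]: "x \<in> carrier G \<Longrightarrow> conjugate \<one> x = x"
  by (simp add: conjugate_def)

lemma conjugate_mult:
  "\<lbrakk>g \<in> carrier G; h \<in> carrier G; x \<in> carrier G\<rbrakk> \<Longrightarrow> conjugate (g \<otimes> h) x = conjugate g (conjugate h x)"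
  by (simp add: conjugate_def m_assoc inv_mult_group)

lemma conjugate_inv_cancel [simp]:
  "\<lbrakk>g \<in> carrier G; x \<in> carrier G\<rbrakk> \<Longrightarrow> conjugate (inv g) (conjugate g x) = x"
  "\<lbrakk>g \<in> carrier G; x \<in> carrier G\<rbrakk> \<Longrightarrow> conjugate g (conjugate (inv g) x) = x"
  by (simp_all flip: conjugate_mult)

lemma conjugate_distrib:
  assumes "g \<in> carrier G" "x \<in> carrier G" "y \<in> carrier G"
  shows "conjugate g (x \<otimes> y) = conjugate g x \<otimes> conjugate g y"
proof -
  have "inv g \<otimes> (g \<otimes> (y \<otimes> inv g)) = y \<otimes> inv g"
    using assms by (simp flip: m_assoc)
  then show ?thesis
    using assms by (simp add: conjugate_def m_assoc)
qed

lemma conjugate_eq_iff [simp]: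
  "\<lbrakk>g \<in> carrier G; x \<in> carrier G; y \<in> carrier G\<rbrakk> \<Longrightarrow> conjugate g x = conjugate g y \<longleftrightarrow> x = y"
  by (metis conjugate_inv_cancel(1))

lemma conjugate_eq_one_iff [simp]:
  assumes "g \<in> carrier G" "x \<in> carrier G"
  shows "conjugate g x = \<one> \<longleftrightarrow> x = \<one>"
proof -
  have "conjugate g \<one> = \<one>" using assms by (simp add: conjugate_def)
  then show ?thesis using conjugate_eq_iff assms by (metis one_closed)
qed

lemma conjugate_eq_self_iff:
  assumes "g \<in> carrier G" "x \<in> carrier G"
  shows "conjugate g x = x \<longleftrightarrow> g \<otimes> x = x \<otimes> g"
proof
  assume "conjugate g x = x"
  then have "g \<otimes> x \<otimes> inv g \<otimes> g = x \<otimes> g" by (simp add: conjugate_def)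
  then show "g \<otimes> x = x \<otimes> g" using assms by (simp add: m_assoc)
next
  assume "g \<otimes> x = x \<otimes> g"
  then show "conjugate g x = x" using assms by (simp add: conjugate_def m_assoc)
qed

lemma conjugate_pow:
  assumes "g \<in> carrier G" "x \<in> carrier G"
  shows "conjugate g (x [^] (n::nat)) = conjugate g x [^] n"
  using assms by (induction n) (simp_all add: conjugate_distrib)

lemma ord_conjugate:
  assumes "g \<in> carrier G" "x \<in> carrier G"
  shows "ord (conjugate g x) = ord x"
  using assms by (subst ord_unique) (simp_all add: pow_eq_id flip: conjugate_pow)

section \<open>Orders of powers and of commuting products\<close>

lemma ord_powE:
  assumes x: "x \<in> carrier G" and d: "d dvd ord x" and nz: "ord x \<noteq> 0"
  obtains k :: nat where "ord (x [^] k) = d"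
proof
  have "ord x div d dvd ord x" "ord x div d \<noteq> 0"
    using d nz by (auto simp: div_dvd_iff_mult dvd_div_eq_0_iff)
  then show "ord (x [^] (ord x div d)) = d"
    using ord_pow x d nz by (metis dvd_div_mult_self nonzero_mult_div_cancel_left)
qed

text \<open>Raising to the exponent \<open>n * ord y\<close> kills the factor \<open>y\<close>, so
  \<open>ord x\<close> divides \<open>n * ord y\<close>; coprimality removes
  \<open>ord y\<close>.\<close>

lemma ord_dvd_if_pow_mult_eq_one:
  assumes x: "x \<in> carrier G" and y: "y \<in> carrier G" and xy: "x \<otimes> y = y \<otimes> x"
    and cop: "coprime (ord x) (ord y)" and n: "(x \<otimes> y) [^] (n::nat) = \<one>"
  shows "ord x dvd n"
proof -
  have "\<one> = (x \<otimes> y) [^] (n * ord y)"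
    using n x y by (simp flip: nat_pow_pow)
  also have "\<dots> = x [^] (n * ord y) \<otimes> y [^] (n * ord y)"
    using pow_mult_distrib[OF xy x y] .
  also have "y [^] (n * ord y) = \<one>"
    using pow_eq_id[OF y] by simp
  finally have "x [^] (n * ord y) = \<one>"
    using x by simp
  then have "ord x dvd n * ord y"
    using pow_eq_id[OF x] by simp
  then show ?thesis
    using cop by (simp add: coprime_dvd_mult_left_iff)
qed

lemma ord_mult_coprime:
  assumes x: "x \<in> carrier G" and y: "y \<in> carrier G" and xy: "x \<otimes> y = y \<otimes> x"
    and cop: "coprime (ord x) (ord y)"
  shows "ord (x \<otimes> y) = ord x * ord y"
proof (rule dvd_antisym)
  show "ord (x \<otimes> y) dvd ord x * ord y"
    using xy x y by (rule ord_mul_divides)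
  have pow: "(x \<otimes> y) [^] ord (x \<otimes> y) = \<one>"
    using x y by (simp add: pow_ord_eq_1)
  have "ord x dvd ord (x \<otimes> y)"
    using x y xy cop pow by (rule ord_dvd_if_pow_mult_eq_one)
  moreover have "ord y dvd ord (x \<otimes> y)"
  proof (rule ord_dvd_if_pow_mult_eq_one[OF y x xy[symmetric]])
    show "coprime (ord y) (ord x)" using cop by (simp add: coprime_commute)
    show "(y \<otimes> x) [^] ord (x \<otimes> y) = \<one>" using pow unfolding xy .
  qed
  ultimately show "ord x * ord y dvd ord (x \<otimes> y)"
    using cop by (rule divides_mult)
qed

section \<open>Subgroup orders, Cauchy's theorem and a Sylow argument\<close>

lemma card_subgroup_dvd:
  assumes "subgroup H G" "subgroup K G" "H \<subseteq> K"
  shows "card H dvd card K"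
proof -
  have "subgroup H (G\<lparr>carrier := K\<rparr>)"
    using assms subgroup_incl by blast
  from group.lagrange[OF subgroup_imp_group[OF assms(2)] this]
  have "card (rcosets\<^bsub>G\<lparr>carrier := K\<rparr>\<^esub> H) * card H = card K"
    by (simp add: order_def)
  then show ?thesis
    by (metis dvd_triv_right)
qed

lemma exists_prime_dvd_ord:
  assumes fin: "finite (carrier G)"
    and p: "normalization_semidom_class.prime (p::nat)" and dvd: "p dvd order G"
  obtains x where "x \<in> carrier G" "p dvd ord x"
proof -
  \<comment> \<open>\<open>sylow_thm\<close> does not ask for the full power of \<open>p\<close>;
    the exponent 1 yields a subgroup of order \<open>p\<close>, in which every element other than
    \<one> has order \<open>p\<close>.\<close>
  obtain m where m: "order G = p ^ 1 * m"
    using dvd by auto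
  obtain P where P: "subgroup P G" "card P = p"
    using sylow_thm[OF p group_axioms m fin] by auto
  have "card P \<noteq> 1" using P p by auto
  then obtain x where x: "x \<in> P" "x \<noteq> \<one>"
    using subgroup.one_closed[OF P(1)] by (metis is_singletonI' is_singleton_altdef empty_iff)
  have xG: "x \<in> carrier G" using x P(1) subgroup.subset by blast
  have "generate G {x} \<subseteq> P"
    using generate_subgroup_incl[of "{x}" P] x P(1) by blast
  then have "card (generate G {x}) dvd p"
    using card_subgroup_dvd[OF generate_is_subgroup P(1)] P(2) xG by simp
  then have "ord x dvd p"
    using generate_pow_card[OF xG] by simp
  moreover have "ord x \<noteq> 1"
    using ord_eq_1 xG x by blast
  ultimately have "ord x = p"
    using p by (metis prime_nat_iff)
  then show thesis
    using that xG by simp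
qed

text \<open>The element \<open>z\<close> is chosen before \<open>x\<close> and depends only on
  \<open>p\<close>. This uniformity is what makes two components with elements of order
  \<open>p\<close> comparable: both contain conjugates of the same \<open>z\<close>.\<close>

lemma ord_prime_imp_commutes_conjugate:
  assumes fin: "finite (carrier G)"
    and p: "normalization_semidom_class.prime (p::nat)" and dvd: "p dvd order G"
  obtains z where "z \<in> carrier G" "z \<noteq> \<one>"
    "\<And>x. \<lbrakk>x \<in> carrier G; ord x = p\<rbrakk> \<Longrightarrow>
       \<exists>g \<in> carrier G. x \<otimes> conjugate g z = conjugate g z \<otimes> x"
proof -
  define \<phi> where "\<phi> = (\<lambda>g. \<lambda>h \<in> carrier G. g \<otimes> h \<otimes> inv g)"
  interpret \<phi>: group_action G "carrier G" \<phi>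
    unfolding \<phi>_def by (rule action_by_conjugation)
  have \<phi>: "\<phi> g x = conjugate g x" if "x \<in> carrier G" for g x
    using that by (simp add: \<phi>_def conjugate_def)
  have nz: "order G \<noteq> 0"
    using fin by (simp add: order_gt_0_iff_finite)
  obtain m where m: "order G = p ^ multiplicity p (order G) * m" "\<not> p dvd m"
    using p nz by (metis multiplicity_decompose' not_prime_unit)
  define a where "a = multiplicity p (order G)"
  have a: "a \<noteq> 0"
    using m dvd by (auto simp: a_def intro!: Nat.gr0I)
  obtain P where P: "subgroup P G" "card P = p ^ a"
    using sylow_thm[OF p group_axioms, of a m] m fin by (auto simp: a_def)
  have Psub: "P \<subseteq> carrier G"
    using P(1) by (rule subgroup.subset)
  have finP: "finite P"
    using Psub fin by (rule finite_subset)
  interpret P: group_action "G\<lparr>carrier := P\<rparr>" "carrier G" \<phi>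
    by (rule \<phi>.induced_action[OF P(1)])
  define Z where "Z = {x. \<forall>g \<in> P. \<phi> g x = x}"
  \<comment> \<open>\<open>P\<close> acts on itself by conjugation, and \<open>P \<inter> Z\<close>
    is the centre of \<open>P\<close>. Its size is a multiple of \<open>p\<close>, hence not 1,
    which gives the central \<open>z\<close> below.\<close>
  have "p dvd card (P - Z)"
    using P.p_group_fixed_points[OF p, of a P] P Psub finP
    by (simp add: Z_def order_def \<phi> conjugate_def subset_iff subgroup.m_closed subgroup.m_inv_closed)
  moreover have "p dvd card P"
    using P(2) a by simp
  moreover have "card P = card (P \<inter> Z) + card (P - Z)"
    using finP by (simp add: card_Int_Diff)
  ultimately have "p dvd card (P \<inter> Z)"
    by (simp add: dvd_add_left_iff)
  moreover have "\<one> \<in> P \<inter> Z"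
    using Psub P(1) by (auto simp: Z_def \<phi> conjugate_def subgroup.one_closed subset_iff)
  ultimately have "P \<inter> Z \<noteq> {\<one>}"
    using p by (auto simp: not_prime_unit)
  with \<open>\<one> \<in> P \<inter> _\<close> obtain z where z: "z \<in> P" "z \<noteq> \<one>" "\<forall>g \<in> P. \<phi> g z = z"
    unfolding Z_def by blast
  have zG: "z \<in> carrier G" using z(1) Psub by blast
  have "P \<subseteq> stabilizer G \<phi> z"
    using z(3) Psub by (auto simp: stabilizer_def)
  moreover have stab: "subgroup (stabilizer G \<phi> z) G"
    by (rule \<phi>.stabilizer_subgroup[OF zG])
  ultimately have "card P dvd card (stabilizer G \<phi> z)"
    using card_subgroup_dvd P(1) by blast
  then obtain k where k: "card (stabilizer G \<phi> z) = p ^ a * k"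
    using P(2) by auto
  \<comment> \<open>The centralizer of \<open>z\<close> contains \<open>P\<close> and so absorbs the
    whole \<open>p\<close>-part of the group order; the class size divides \<open>m\<close>, which
    is prime to \<open>p\<close>.\<close>
  have "card (orbit G \<phi> z) * (p ^ a * k) = p ^ a * m"
    using \<phi>.orbit_stabilizer_theorem[OF zG] k m(1) by (simp add: a_def)
  then have "card (orbit G \<phi> z) * k = m"
    using p by auto
  then have ndvd: "\<not> p dvd card (orbit G \<phi> z)"
    using m(2) by auto
  have orb: "orbit G \<phi> z \<subseteq> carrier G"
    using zG by (auto simp: orbit_def \<phi>)
  have "\<exists>g \<in> carrier G. x \<otimes> conjugate g z = conjugate g z \<otimes> x" if x: "x \<in> carrier G" "ord x = p" for x
  proof -
    define C where "C = generate G {x}"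
    have C: "subgroup C G" "card C = p" "x \<in> C"
      using x generate_is_subgroup[of "{x}"] generate_pow_card[of x]
      by (auto simp: C_def intro: generate.incl)
    then have Csub: "C \<subseteq> carrier G" by (simp add: subgroup.subset)
    interpret C: group_action "G\<lparr>carrier := C\<rparr>" "carrier G" \<phi>
      by (rule \<phi>.induced_action[OF C(1)])
    have "\<phi> g y \<in> orbit G \<phi> z" if g: "g \<in> C" and y: "y \<in> orbit G \<phi> z" for g y
    proof -
      have gG: "g \<in> carrier G" using g Csub by blast
      obtain h where h: "h \<in> carrier G" "y = conjugate h z"
        using y zG by (auto simp: orbit_def \<phi>)
      then have "\<phi> g y = \<phi> (g \<otimes> h) z"
        using gG zG by (simp add: \<phi> conjugate_mult)
      then show ?thesis
        using gG h by (auto simp: orbit_def)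
    qed
    \<comment> \<open>The cyclic group \<open>C\<close> of order \<open>p\<close> acts on the
      conjugacy class of \<open>z\<close>. Since \<open>p\<close> does not divide the class size,
      some member \<open>y\<close> is fixed by \<open>C\<close>, in particular by
      \<open>x\<close>.\<close>
    then have "p dvd card (orbit G \<phi> z - {x. \<forall>g \<in> C. \<phi> g x = x})"
      using C.p_group_fixed_points[OF p, of 1 "orbit G \<phi> z"] C orb finite_subset[OF orb fin]
      by (simp add: order_def)
    then have "orbit G \<phi> z - {x. \<forall>g \<in> C. \<phi> g x = x} \<noteq> orbit G \<phi> z"
      using ndvd by metis
    then obtain y where y: "y \<in> orbit G \<phi> z" "\<forall>g \<in> C. \<phi> g y = y" by blast
    then obtain g where g: "g \<in> carrier G" "y = conjugate g z"
      using zG by (auto simp: orbit_def \<phi>)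
    have "conjugate x y = y"
      using y C(3) orb by (metis \<phi> subsetD)
    then show ?thesis
      using g x zG conjugate_eq_self_iff by auto
  qed
  then show thesis
    using that zG z(2) by blast
qed

end


section \<open>The commuting graph and the prime graph\<close>

lemma (in group) commuting_graph_centreless:
  assumes "group_center G = {\<one>}"
  shows "pverts (commuting_graph G) = carrier G - {\<one>}"
    "(x, y) \<in> parcs (commuting_graph G) \<longleftrightarrow>
      x \<in> carrier G - {\<one>} \<and> y \<in> carrier G - {\<one>} \<and> x \<noteq> y \<and> x \<otimes> y = y \<otimes> x"
  using assms by (auto simp: commuting_graph_def)

locale finite_centreless_group = group G for G (structure) +
  assumes fin: "finite (carrier G)"
    and center: "group_center G = {\<one>}"
begin

abbreviation "comps \<equiv> graph_components (commuting_graph G)"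
abbreviation "prime_comps \<equiv> graph_components (prime_graph G)"

interpretation cg: pair_sym_digraph "commuting_graph G"
  by (rule pair_sym_digraph_commuting_graph)

interpretation pg: pair_sym_digraph "prime_graph G"
  by (rule pair_sym_digraph_prime_graph)

lemmas cg_simps = commuting_graph_centreless[OF center]

lemma compsD:
  assumes "\<Psi> \<in> comps" "x \<in> \<Psi>"
  shows "x \<in> carrier G" "x \<noteq> \<one>" "ord x \<noteq> 0"
proof -
  show x: "x \<in> carrier G" "x \<noteq> \<one>"
    using cg.graph_components_subset assms cg_simps by blast+
  show "ord x \<noteq> 0"
    using ord_ge_1[OF fin] x by (metis not_one_le_zero)
qed

lemma comps_closed:
  assumes "\<Psi> \<in> comps" "x \<in> \<Psi>" "y \<in> carrier G" "y \<noteq> \<one>" "x \<otimes> y = y \<otimes> x"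
  shows "y \<in> \<Psi>"
proof (cases "x = y")
  case False
  then have "(x, y) \<in> parcs (commuting_graph G)"
    using compsD[OF assms(1,2)] assms(3-5) by (simp add: cg_simps)
  with assms(1,2) show ?thesis
    by (rule cg.graph_components_closed)
qed (use assms in simp)

lemma comps_subset_closed:
  assumes \<Psi>: "\<Psi> \<in> comps" "x \<in> \<Psi>" "x \<in> A"
    and closed: "\<And>y z. \<lbrakk>y \<in> A; y \<in> carrier G; z \<in> carrier G; y \<noteq> \<one>; z \<noteq> \<one>; y \<otimes> z = z \<otimes> y\<rbrakk> \<Longrightarrow> z \<in> A"
  shows "\<Psi> \<subseteq> A"
proof (rule cg.graph_component_subset_closed[OF \<Psi>])
  fix y z assume "y \<in> A" "(y, z) \<in> parcs (commuting_graph G)"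
  then show "z \<in> A"
    using closed[of y z] by (simp add: cg_simps)
qed

lemma comps_cover:
  assumes "x \<in> carrier G" "x \<noteq> \<one>"
  obtains \<Psi> where "\<Psi> \<in> comps" "x \<in> \<Psi>"
proof -
  have "x \<in> pverts (commuting_graph G)"
    using assms by (simp add: cg_simps)
  then show thesis
    using that by (rule cg.graph_components_cover)
qed

text \<open>A power of \<open>x\<close> commutes with \<open>x\<close>, so a power different from
  \<one> stays in the same component. Thus a prime divisor of an order in \<open>\<Psi>\<close> may
  be taken to be an order in \<open>\<Psi>\<close>.\<close>

lemma comps_prime_elementE:
  assumes \<Psi>: "\<Psi> \<in> comps" "x \<in> \<Psi>"
    and p: "normalization_semidom_class.prime p" "p dvd ord x"
  obtains k :: nat where "x [^] k \<in> \<Psi>" "ord (x [^] k) = p"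
proof -
  note x = compsD[OF \<Psi>]
  obtain k :: nat where k: "ord (x [^] k) = p"
    using ord_powE x p by blast
  then have "x [^] k \<noteq> \<one>"
    using p(1) by (metis not_prime_1 ord_id)
  then show thesis
    using that k comps_closed[OF \<Psi>, of "x [^] k"] x by (metis group_commutes_pow nat_pow_closed)
qed

section \<open>The conjugation action on the components\<close>

lemma conjugate_image_subset:
  assumes \<Psi>: "\<Psi> \<in> comps" and \<Theta>: "\<Theta> \<in> comps" and g: "g \<in> carrier G"
    and x: "x \<in> \<Psi>" "conjugate g x \<in> \<Theta>"
  shows "conjugate g ` \<Psi> \<subseteq> \<Theta>"
proof -
  \<comment> \<open>Conjugation preserves commuting, so the preimage of \<open>\<Theta>\<close> is
    closed under adjacency; it meets \<open>\<Psi>\<close> in \<open>x\<close>.\<close>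
  have "\<Psi> \<subseteq> {y \<in> carrier G. conjugate g y \<in> \<Theta>}"
  proof (rule comps_subset_closed[OF \<Psi> x(1)])
    show "x \<in> {y \<in> carrier G. conjugate g y \<in> \<Theta>}"
      using x compsD[OF \<Psi>] by simp
    fix y z assume y: "y \<in> {y \<in> carrier G. conjugate g y \<in> \<Theta>}" and z: "z \<in> carrier G" "z \<noteq> \<one>"
      and yz: "y \<otimes> z = z \<otimes> y"
    have "conjugate g y \<otimes> conjugate g z = conjugate g z \<otimes> conjugate g y"
      using y z yz g by (simp flip: conjugate_distrib)
    then have "conjugate g z \<in> \<Theta>"
      using comps_closed[OF \<Theta>, of "conjugate g y"] y z g by simp
    then show "z \<in> {y \<in> carrier G. conjugate g y \<in> \<Theta>}"
      using z by simp
  qed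
  then show ?thesis by blast
qed

lemma conjugate_image_eq:
  assumes \<Psi>: "\<Psi> \<in> comps" and \<Theta>: "\<Theta> \<in> comps" and g: "g \<in> carrier G"
    and x: "x \<in> \<Psi>" "conjugate g x \<in> \<Theta>"
  shows "conjugate g ` \<Psi> = \<Theta>"
proof
  show "conjugate g ` \<Psi> \<subseteq> \<Theta>"
    using assms by (rule conjugate_image_subset)
  have "conjugate (inv g) ` \<Theta> \<subseteq> \<Psi>"
    using conjugate_image_subset[OF \<Theta> \<Psi>, of "inv g" "conjugate g x"] x g compsD[OF \<Psi>] by simp
  then show "\<Theta> \<subseteq> conjugate g ` \<Psi>"
    using compsD[OF \<Theta>] g by (metis (no_types, lifting) conjugate_inv_cancel(2) image_eqI image_subset_iff subsetI)
qed

lemma conjugate_image_comps: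
  assumes \<Psi>: "\<Psi> \<in> comps" and g: "g \<in> carrier G"
  shows "conjugate g ` \<Psi> \<in> comps"
proof -
  obtain x where x: "x \<in> \<Psi>" using cg.graph_components_nonempty[OF \<Psi>] by blast
  then have "conjugate g x \<in> carrier G" "conjugate g x \<noteq> \<one>"
    using compsD[OF \<Psi>] g by simp_all
  then obtain \<Theta> where "\<Theta> \<in> comps" "conjugate g x \<in> \<Theta>" by (rule comps_cover)
  then show ?thesis using conjugate_image_eq[OF \<Psi> _ g x] by simp
qed

lemma component_conjugation_eq:
  "\<Psi> \<in> comps \<Longrightarrow> component_conjugation G g \<Psi> = conjugate g ` \<Psi>"
  by (simp add: component_conjugation_def conjugate_def)

lemma conjugate_image_mult:
  assumes "\<Psi> \<in> comps" "g \<in> carrier G" "h \<in> carrier G"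
  shows "conjugate (g \<otimes> h) ` \<Psi> = conjugate g ` conjugate h ` \<Psi>"
  using assms compsD[OF assms(1)] by (auto simp: conjugate_mult image_image)

lemma conjugate_image_one:
  assumes "\<Psi> \<in> comps"
  shows "conjugate \<one> ` \<Psi> = \<Psi>"
  using compsD[OF assms] by (simp add: image_def)

lemma component_conjugation_action: "group_action G comps (component_conjugation G)"
proof -
  have Bij: "component_conjugation G g \<in> Bij comps" if g: "g \<in> carrier G" for g
  proof -
    have "bij_betw (component_conjugation G g) comps comps"
      by (rule bij_betw_byWitness[where f' = "component_conjugation G (inv g)"])
        (use g in \<open>auto simp: component_conjugation_eq conjugate_image_comps conjugate_image_one
          simp flip: conjugate_image_mult\<close>)
    then show ?thesis
      by (simp add: Bij_def component_conjugation_def)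
  qed
  have "component_conjugation G (g \<otimes> h) =
      component_conjugation G g \<otimes>\<^bsub>BijGroup comps\<^esub> component_conjugation G h"
    if gh: "g \<in> carrier G" "h \<in> carrier G" for g h
  \<comment> \<open>Both sides are undefined off \<open>comps\<close> in the same way, so comparing
    them on components suffices.\<close>
  proof (rule extensionalityI[where A = comps])
    fix \<Psi> assume "\<Psi> \<in> comps"
    with gh Bij show "component_conjugation G (g \<otimes> h) \<Psi> =
        (component_conjugation G g \<otimes>\<^bsub>BijGroup comps\<^esub> component_conjugation G h) \<Psi>"
      by (simp add: BijGroup_def compose_def component_conjugation_eq conjugate_image_comps conjugate_image_mult)
  qed (use gh Bij in \<open>simp_all add: BijGroup_def component_conjugation_def\<close>)
  then have "component_conjugation G \<in> hom G (BijGroup comps)"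
    using Bij by (auto simp: hom_def BijGroup_def)
  then show ?thesis
    by (simp add: group_action_def group_hom_def group_hom_axioms_def group_BijGroup)
qed

section \<open>Primes of components and components of the prime graph\<close>

lemma component_primes_conjugate_image:
  assumes "\<Psi> \<in> comps" "g \<in> carrier G"
  shows "component_primes G (conjugate g ` \<Psi>) = component_primes G \<Psi>"
  using compsD[OF assms(1)] assms(2) by (simp add: component_primes_def ord_conjugate cong: conj_cong bex_cong)

text \<open>Elements of order \<open>p\<close> in the two components commute with conjugates of one
  and the same \<open>z\<close> by \<open>g\<close> and \<open>h\<close>. These conjugates then lie
  in \<open>\<Psi>\<close> and \<open>\<Theta>\<close>, and \<open>h \<otimes> inv g\<close> carries
  the first to the second.\<close>

lemma comps_common_prime_conjugate:
  assumes \<Psi>: "\<Psi> \<in> comps" and \<Theta>: "\<Theta> \<in> comps"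
    and p: "p \<in> component_primes G \<Psi>" "p \<in> component_primes G \<Theta>"
  obtains g where "g \<in> carrier G" "\<Theta> = conjugate g ` \<Psi>"
proof -
  have prime: "normalization_semidom_class.prime p"
    using p by (simp add: component_primes_def)
  obtain x where x: "x \<in> \<Psi>" "ord x = p"
    using p(1) comps_prime_elementE[OF \<Psi>] unfolding component_primes_def by blast
  obtain y where y: "y \<in> \<Theta>" "ord y = p"
    using p(2) comps_prime_elementE[OF \<Theta>] unfolding component_primes_def by blast
  note xG = compsD[OF \<Psi> x(1)] and yG = compsD[OF \<Theta> y(1)]
  have "p dvd order G"
    using ord_dvd_group_order xG x(2) by metis
  then obtain z where z: "z \<in> carrier G" "z \<noteq> \<one>"
    "\<And>x. \<lbrakk>x \<in> carrier G; ord x = p\<rbrakk> \<Longrightarrow> \<exists>g \<in> carrier G. x \<otimes> conjugate g z = conjugate g z \<otimes> x"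
    using ord_prime_imp_commutes_conjugate[OF fin prime] by blast
  obtain g where g: "g \<in> carrier G" "x \<otimes> conjugate g z = conjugate g z \<otimes> x"
    using z(3) x xG by blast
  obtain h where h: "h \<in> carrier G" "y \<otimes> conjugate h z = conjugate h z \<otimes> y"
    using z(3) y yG by blast
  have "conjugate g z \<in> \<Psi>" "conjugate h z \<in> \<Theta>"
    using comps_closed[OF \<Psi> x(1)] comps_closed[OF \<Theta> y(1)] g h z by simp_all
  moreover have "conjugate (h \<otimes> inv g) (conjugate g z) = conjugate h z"
    using g h z by (simp add: conjugate_mult)
  ultimately have "conjugate (h \<otimes> inv g) ` \<Psi> = \<Theta>"
    using conjugate_image_eq[OF \<Psi> \<Theta>, of "h \<otimes> inv g" "conjugate g z"] g h by simp
  then show thesis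
    using that[of "h \<otimes> inv g"] g h by simp
qed

lemma component_primes_nonempty:
  assumes \<Psi>: "\<Psi> \<in> comps"
  shows "component_primes G \<Psi> \<noteq> {}"
proof -
  obtain x where x: "x \<in> \<Psi>" using cg.graph_components_nonempty[OF \<Psi>] by blast
  then have "ord x \<noteq> 1" using compsD[OF \<Psi> x] ord_eq_1[of x] by simp
  then obtain p where "normalization_semidom_class.prime p" "p dvd ord x"
    by (metis prime_factor_nat)
  then show ?thesis using x by (auto simp: component_primes_def)
qed

lemma prime_graph_adjacent:
  assumes x: "x \<in> carrier G" "y \<in> carrier G" "x \<otimes> y = y \<otimes> x"
    and p: "normalization_semidom_class.prime p" "normalization_semidom_class.prime q" "p \<noteq> q"
    and ord: "ord x = p" "ord y = q"
  shows "(p, q) \<in> parcs (prime_graph G)"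
proof -
  have "ord (x \<otimes> y) = p * q"
    using ord_mult_coprime x p ord primes_coprime by metis
  then show ?thesis
    using x p ord ord_dvd_group_order by (auto simp: prime_graph_def)
qed

lemma component_primes_comps:
  assumes \<Psi>: "\<Psi> \<in> comps" and T: "T \<in> prime_comps" and p: "p \<in> component_primes G \<Psi>" "p \<in> T"
  shows "component_primes G \<Psi> = T"
proof
  \<comment> \<open>One edge of the commuting graph: suitable powers of \<open>x\<close> and
    \<open>y\<close> have orders \<open>r\<close> and \<open>q\<close> and commute, so
    \<open>r\<close> and \<open>q\<close> are equal or adjacent in the prime graph.\<close>
  have dvd_T: "q \<in> T" if x: "x \<in> carrier G" "ord x \<noteq> 0" and y: "y \<in> carrier G" "ord y \<noteq> 0"
    and xy: "x \<otimes> y = y \<otimes> x" and r: "r \<in> T" "normalization_semidom_class.prime r" "r dvd ord x"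
    and q: "normalization_semidom_class.prime q" "q dvd ord y" for x y r q
  proof -
    obtain k :: nat where k: "ord (x [^] k) = r" using ord_powE x r by blast
    obtain l :: nat where l: "ord (y [^] l) = q" using ord_powE y q by blast
    have "x [^] k \<otimes> y = y \<otimes> x [^] k" using group_commutes_pow x y xy by blast
    then have "x [^] k \<otimes> y [^] l = y [^] l \<otimes> x [^] k"
      using group_commutes_pow[of y "x [^] k" l] x y by simp
    then have "r \<noteq> q \<Longrightarrow> (r, q) \<in> parcs (prime_graph G)"
      using prime_graph_adjacent[of "x [^] k" "y [^] l"] k l x y r q by simp
    then show "q \<in> T"
      using pg.graph_components_closed[OF T r(1)] r by blast
  qed
  obtain x where x: "x \<in> \<Psi>" "p dvd ord x" and prime: "normalization_semidom_class.prime p"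
    using p(1) by (auto simp: component_primes_def)
  define A where "A = {y \<in> carrier G. ord y \<noteq> 0 \<and> (\<forall>q. normalization_semidom_class.prime q \<and> q dvd ord y \<longrightarrow> q \<in> T)}"
  have "\<Psi> \<subseteq> A"
  proof (rule comps_subset_closed[OF \<Psi> x(1)])
    \<comment> \<open>Taking \<open>x\<close> for both commuting elements spreads membership in
      \<open>T\<close> from \<open>p\<close> to all primes dividing \<open>ord x\<close>.\<close>
    show "x \<in> A"
      using dvd_T[of x x p] x compsD[OF \<Psi> x(1)] p prime by (auto simp: A_def)
    fix y z assume y: "y \<in> A" "y \<noteq> \<one>" and z: "z \<in> carrier G" "z \<noteq> \<one>" and yz: "y \<otimes> z = z \<otimes> y"
    have "ord y \<noteq> 1" using y ord_eq_1[of y] by (auto simp: A_def)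
    then obtain r where r: "normalization_semidom_class.prime r" "r dvd ord y"
      by (metis prime_factor_nat)
    moreover have "ord z \<noteq> 0"
      using ord_ge_1[OF fin z(1)] by simp
    ultimately show "z \<in> A"
      using dvd_T[of y z r] y z yz by (auto simp: A_def)
  qed
  then show "component_primes G \<Psi> \<subseteq> T"
    by (auto simp: component_primes_def A_def)
  show "T \<subseteq> component_primes G \<Psi>"
  \<comment> \<open>Now the walk is in the prime graph. An edge is witnessed by \<open>w\<close> of
    order \<open>r * s\<close>, whose component \<open>\<Theta>\<close> shares \<open>r\<close> with
    \<open>\<Psi>\<close>; hence \<open>\<Theta>\<close> is conjugate to \<open>\<Psi>\<close> and
    has the same primes, among them \<open>s\<close>.\<close>
  proof (rule pg.graph_component_subset_closed[OF T p(2) p(1)])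
    fix r s assume r: "r \<in> component_primes G \<Psi>" and "(r, s) \<in> parcs (prime_graph G)"
    then obtain w where w: "w \<in> carrier G" "ord w = r * s"
      and rs: "normalization_semidom_class.prime r" "normalization_semidom_class.prime s"
      by (auto simp: prime_graph_def)
    have "w \<noteq> \<one>" using w rs by (metis nat_mult_eq_1_iff not_prime_1 ord_id)
    then obtain \<Theta> where \<Theta>: "\<Theta> \<in> comps" "w \<in> \<Theta>" using comps_cover w by blast
    then have rs_\<Theta>: "r \<in> component_primes G \<Theta>" "s \<in> component_primes G \<Theta>"
      using w rs by (auto simp: component_primes_def intro!: bexI[of _ w])
    obtain g where "g \<in> carrier G" "\<Theta> = conjugate g ` \<Psi>"
      using comps_common_prime_conjugate[OF \<Psi> \<Theta>(1) r rs_\<Theta>(1)] by blast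
    then show "s \<in> component_primes G \<Psi>"
      using rs_\<Theta>(2) component_primes_conjugate_image[OF \<Psi>] by simp
  qed
qed

lemma component_primes_in_prime_comps:
  assumes \<Psi>: "\<Psi> \<in> comps"
  shows "component_primes G \<Psi> \<in> prime_comps"
proof -
  obtain p where p: "p \<in> component_primes G \<Psi>"
    using component_primes_nonempty[OF \<Psi>] by blast
  then have "p \<in> pverts (prime_graph G)"
    using compsD[OF \<Psi>] ord_dvd_group_order
    by (auto simp: component_primes_def prime_graph_def intro: dvd_trans)
  then obtain T where "T \<in> prime_comps" "p \<in> T"
    by (rule pg.graph_components_cover)
  then show ?thesis
    using component_primes_comps[OF \<Psi> _ p] by metis
qed

lemma component_primes_image: "component_primes G ` comps = prime_comps"
proof
  show "component_primes G ` comps \<subseteq> prime_comps"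
    using component_primes_in_prime_comps by blast
  show "prime_comps \<subseteq> component_primes G ` comps"
  proof
    fix T assume T: "T \<in> prime_comps"
    obtain p where p: "p \<in> T" using pg.graph_components_nonempty[OF T] by blast
    then have prime: "normalization_semidom_class.prime p" "p dvd order G"
      using pg.graph_components_subset[OF T] by (auto simp: prime_graph_def)
    obtain x where x: "x \<in> carrier G" "p dvd ord x"
      using exists_prime_dvd_ord[OF fin prime] by blast
    then have "x \<noteq> \<one>" using prime by auto
    then obtain \<Psi> where \<Psi>: "\<Psi> \<in> comps" "x \<in> \<Psi>" using comps_cover x by blast
    then have "p \<in> component_primes G \<Psi>"
      using x prime by (auto simp: component_primes_def)
    then show "T \<in> component_primes G ` comps"
      using component_primes_comps[OF \<Psi>(1) T _ p] \<Psi>(1) by blast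
  qed
qed

text \<open>Equal prime sets are nonempty, so they share a prime and force conjugacy, and
  \<open>R\<close> meets each orbit only once. Surjectivity passes from all components to
  \<open>R\<close> because the prime set is constant on orbits.\<close>

lemma bij_betw_component_primes:
  assumes R: "component_class_representatives G R"
  shows "bij_betw (component_primes G) R prime_comps"
proof (rule bij_betwI')
  interpret action: group_action G comps "component_conjugation G"
    by (rule component_conjugation_action)
  let ?orb = "orbit G (component_conjugation G)"
  have Rsub: "R \<subseteq> comps" and
    rep: "\<Psi> \<in> comps \<Longrightarrow> \<exists>!\<Theta>. \<Theta> \<in> R \<and> \<Theta> \<in> ?orb \<Psi>" for \<Psi>
    using R by (auto simp: component_class_representatives_def orbits_def)
  have in_orb: "\<Theta> \<in> ?orb \<Psi> \<longleftrightarrow> (\<exists>g \<in> carrier G. \<Theta> = conjugate g ` \<Psi>)" if "\<Psi> \<in> comps" for \<Psi> \<Theta>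
    using component_conjugation_eq[OF that] by (auto simp: orbit_def)
  show "component_primes G \<Psi> = component_primes G \<Theta> \<longleftrightarrow> \<Psi> = \<Theta>"
    if \<Psi>R: "\<Psi> \<in> R" and \<Theta>R: "\<Theta> \<in> R" for \<Psi> \<Theta>
  proof
    assume eq: "component_primes G \<Psi> = component_primes G \<Theta>"
    have \<Psi>: "\<Psi> \<in> comps" and \<Theta>: "\<Theta> \<in> comps" using \<Psi>R \<Theta>R Rsub by blast+
    obtain p where "p \<in> component_primes G \<Psi>"
      using component_primes_nonempty[OF \<Psi>] by blast
    then obtain g where "g \<in> carrier G" "\<Theta> = conjugate g ` \<Psi>"
      using comps_common_prime_conjugate[OF \<Psi> \<Theta>] eq by metis
    then have "\<Theta> \<in> ?orb \<Psi>" using in_orb[OF \<Psi>] by blast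
    then show "\<Psi> = \<Theta>"
      using rep[OF \<Psi>] action.orbit_refl[OF \<Psi>] \<Psi>R \<Theta>R by blast
  qed simp
  show "component_primes G \<Psi> \<in> prime_comps" if "\<Psi> \<in> R" for \<Psi>
    using component_primes_in_prime_comps that Rsub by blast
  show "\<exists>\<Psi> \<in> R. T = component_primes G \<Psi>" if T: "T \<in> prime_comps" for T
  proof -
    obtain \<Psi> where \<Psi>: "\<Psi> \<in> comps" "component_primes G \<Psi> = T"
      using T[folded component_primes_image] by blast
    obtain \<Theta> where "\<Theta> \<in> R" "\<Theta> \<in> ?orb \<Psi>" using rep[OF \<Psi>(1)] by blast
    then show ?thesis
      using in_orb[OF \<Psi>(1)] component_primes_conjugate_image[OF \<Psi>(1)] \<Psi>(2) by metis
  qed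
qed

section \<open>Connectedness by counting\<close>

lemma comps_singleton_if_conjugate:
  assumes \<Psi>: "\<Psi> \<in> comps"
    and all_conjugate: "\<And>\<Theta>. \<Theta> \<in> comps \<Longrightarrow> \<exists>g \<in> carrier G. \<Theta> = conjugate g ` \<Psi>"
  shows "comps = {\<Psi>}"
proof -
  interpret action: group_action G comps "component_conjugation G"
    by (rule component_conjugation_action)
  define H where "H = stabilizer G (component_conjugation G) \<Psi>"
  have "orbit G (component_conjugation G) \<Psi> = (\<lambda>g. conjugate g ` \<Psi>) ` carrier G"
    unfolding orbit_def component_conjugation_eq[OF \<Psi>] by (rule Setcompr_eq_image)
  also have "\<dots> = comps"
  proof
    show "(\<lambda>g. conjugate g ` \<Psi>) ` carrier G \<subseteq> comps"
      using conjugate_image_comps[OF \<Psi>] by (rule image_subsetI)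
    show "comps \<subseteq> (\<lambda>g. conjugate g ` \<Psi>) ` carrier G"
    proof
      fix \<Theta> assume "\<Theta> \<in> comps"
      from all_conjugate[OF this] show "\<Theta> \<in> (\<lambda>g. conjugate g ` \<Psi>) ` carrier G"
        by (elim bexE) (rule image_eqI)
    qed
  qed
  finally have "orbit G (component_conjugation G) \<Psi> = comps" .
  then have orb: "card comps * card H = order G"
    using action.orbit_stabilizer_theorem[OF \<Psi>] by (simp add: H_def)
  have fin_comp: "finite \<Theta>" if "\<Theta> \<in> comps" for \<Theta>
    using compsD[OF that] fin by (meson finite_subset subsetI)
  have card_eq: "card \<Theta> = card \<Psi>" if \<Theta>: "\<Theta> \<in> comps" for \<Theta>
  proof -
    obtain g where g: "g \<in> carrier G" "\<Theta> = conjugate g ` \<Psi>" using all_conjugate[OF \<Theta>] by blast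
    then have "inj_on (conjugate g) \<Psi>"
      using compsD[OF \<Psi>] by (auto simp: inj_on_def)
    then show ?thesis using g card_image by blast
  qed
  have "\<Union> comps = carrier G - {\<one>}"
    using compsD comps_cover by blast
  moreover have "card (\<Union> comps) = sum card comps"
    using cg.graph_components_eqI fin_comp
    by (intro card_Union_disjoint) (auto simp: pairwise_def disjnt_def)
  moreover have "sum card comps = card comps * card \<Psi>"
    using card_eq by simp
  \<comment> \<open>The components partition the elements other than \<one> into sets of equal
    size.\<close>
  ultimately have count: "order G - 1 = card comps * card \<Psi>"
    using fin by (simp add: order_def)
  have "insert \<one> \<Psi> \<subseteq> H"
  proof -
    \<comment> \<open>Conjugation by \<open>x\<close> fixes \<open>x\<close>, so the image of
      \<open>\<Psi>\<close> meets \<open>\<Psi>\<close> in \<open>x\<close> itself.\<close>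
    have "conjugate x ` \<Psi> = \<Psi>" if x: "x \<in> \<Psi>" for x
      using conjugate_image_eq[OF \<Psi> \<Psi> _ x, of x] x compsD[OF \<Psi> x] conjugate_eq_self_iff[of x x] by simp
    then show ?thesis
      using compsD[OF \<Psi>] conjugate_image_one[OF \<Psi>]
      by (auto simp: H_def stabilizer_def component_conjugation_eq[OF \<Psi>])
  qed
  moreover have "finite H"
    using fin by (simp add: H_def stabilizer_def)
  ultimately have "card (insert \<one> \<Psi>) \<le> card H"
    by (rule card_mono[rotated])
  moreover have "\<one> \<notin> \<Psi>" using compsD[OF \<Psi>] by blast
  ultimately have "card \<Psi> + 1 \<le> card H"
    using fin_comp[OF \<Psi>] by simp
  then have "card comps * (card \<Psi> + 1) \<le> order G"
    using orb mult_le_mono2 by metis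
  \<comment> \<open>Expanding the product gives
    \<open>order G - 1 + card comps \<le> order G\<close>, with \<open>order G\<close>
    positive.\<close>
  then have "card comps \<le> 1"
    using count order_gt_0_iff_finite fin by simp
  \<comment> \<open>An infinite set has \<open>card\<close> 0, so the bound says something about
    \<open>comps\<close> only once it is known to be finite.\<close>
  moreover have "finite comps"
    using fin \<open>\<Union> comps = _\<close> by (metis finite_Diff finite_UnionD)
  ultimately show ?thesis
    using \<Psi> card_le_Suc0_iff_eq[of comps] by auto
qed

text \<open>From left to right only the surjection \<open>component_primes G\<close> is used. In the
  other direction a single prime component makes all components conjugate, and the counting lemma
  applies. For the trivial group both sets are empty and both sides fail.\<close>

lemma comps_singleton_iff: "(\<exists>S. comps = {S}) \<longleftrightarrow> (\<exists>T. prime_comps = {T})"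
proof
  assume "\<exists>S. comps = {S}"
  then obtain S where S: "comps = {S}" by blast
  then have "prime_comps = {component_primes G S}"
    using component_primes_image by simp
  then show "\<exists>T. prime_comps = {T}" by blast
next
  assume "\<exists>T. prime_comps = {T}"
  then obtain T where T: "prime_comps = {T}" by blast
  then have "comps \<noteq> {}" using component_primes_image by auto
  then obtain \<Psi> where \<Psi>: "\<Psi> \<in> comps" by blast
  have "\<exists>g \<in> carrier G. \<Theta> = conjugate g ` \<Psi>" if \<Theta>: "\<Theta> \<in> comps" for \<Theta>
  proof -
    obtain p where "p \<in> component_primes G \<Psi>"
      using component_primes_nonempty[OF \<Psi>] by blast
    moreover have "component_primes G \<Psi> = component_primes G \<Theta>"
      using component_primes_in_prime_comps[OF \<Psi>] component_primes_in_prime_comps[OF \<Theta>] T by simp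
    ultimately show ?thesis
      using comps_common_prime_conjugate[OF \<Psi> \<Theta>] by metis
  qed
  then show "\<exists>S. comps = {S}"
    using comps_singleton_if_conjugate[OF \<Psi>] by blast
qed

end

theorem theorem3p7:
  fixes G :: "('a, 'b) monoid_scheme"
  assumes "group G"
    and "finite (carrier G)"
    and "group_center G = {\<one>\<^bsub>G\<^esub>}"
  shows "(\<forall>R. component_class_representatives G R \<longrightarrow>
            bij_betw (component_primes G) R (graph_components (prime_graph G))) \<and>
         (Digraph_Component.connected (with_proj (commuting_graph G)) \<longleftrightarrow>
          Digraph_Component.connected (with_proj (prime_graph G)))"
proof -
  interpret finite_centreless_group G
    using assms by (simp add: finite_centreless_group_def finite_centreless_group_axioms_def)
  show ?thesis
    using bij_betw_component_primes comps_singleton_iff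
      pair_sym_digraph.connected_iff_graph_components[OF pair_sym_digraph_commuting_graph]
      pair_sym_digraph.connected_iff_graph_components[OF pair_sym_digraph_prime_graph]
    by metis
qed

end
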